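(* Let $d\ge 2$, $n\ge 1$, $m\ge1$ be integers, $N=d^n$, let $t,f$ be integers with $0\le t<n$ and $1\le f\le N$, and let $r=\lfloor\log_d f\rfloor$. Define $$ C(t,f)=\begin{cases} f\big(d^{\lceil\frac{n-r}{2}\rceil-1}-1\big)+d^{\,n-\lceil\frac{n-r}{2}\rceil}-1 & \text{if } t<\lfloor\frac n2\rfloor,\ r\le n-2t-1,\\[4pt] t(d-1)d^{n-t-1}+d^{n-2t-1}-1 & \text{if } t<\lfloor\frac n2\rfloor,\ r\ge n-2t,\\[4pt] [(n-t-1)(d-1)-1]d^{n-t-1}+d^t-(d-1)d^{2t-n-1} & \text{if } t\ge\lfloor\frac n2\rfloor,\ r\ge n-t,\\[4pt] f\big(d^{n-t-r-1}-1\big)+[r(d-1)-1]d^{n-t-1}+d^{n-t-r-1}+d^t-(d-1)d^{2t-n-1} & \text{if } t\ge\lfloor\frac n2\rfloor,\ 2t-n-2<r\le n-t-1,\\[4pt] f\big(d^{n-t-r-1}-1\big)+[r(d-1)-1]d^{n-t-1}+d^{\lfloor\frac{n+r}{2}\rfloor}+f\big(d^{\,n-\lfloor\frac{n+r}{2}\rfloor-1}-1\big) & \text{if } t\ge\lfloor\frac n2\rfloor,\ r\le\min(2t-n-2,\,n-t-1). \end{cases} $$ If $m\ge 1+C(t,f)$, then the network $\log_d(N,0,m)$ is $f$-cast (wide-sense) nonblocking under the window algorithm with window size $d^t$.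
   Context: Network. Let $\mathbb Z_d=\{0,\dots,d-1\}$; for a string $\mathbf s$, $\mathbf s_{i..j}=s_i\cdots s_j$. The $d$-ary inverse Banyan network $\mathrm{BY}^{-1}(n)$ has $N=d^n$ inputs and $N$ outputs, each labelled by the strings in $\mathbb Z_d^n$, and $n$ stages of $d\times d$ switching elements (SEs), the SEs of each stage being labelled by $\mathbb Z_d^{n-1}$. Input $\mathbf x$ is attached to the stage-$1$ SE $\mathbf x_{1..n-1}$ and output $\mathbf y$ to the stage-$n$ SE $\mathbf y_{1..n-1}$. For $1\le i\le n-1$, the stage-$i$ SE $\mathbf z$ is joined by one link to each of the $d$ stage-$(i+1)$ SEs whose labels agree with $\mathbf z$ in all positions except possibly position $i$. The unique route $R(\mathbf x,\mathbf y)$ from input $\mathbf x$ to output $\mathbf y$ passes at stage $j$ through the SE $y_1\cdots y_{j-1}x_j\cdots x_{n-1}$. The network $\log_d(N,0,m)$ consists of $m$ parallel copies (planes) of $\mathrm{BY}^{-1}(n)$; each network input is connected, through a $1\times m$ element with fanout capability, to the equally labelled input of every plane, and each network output is connected to the equally labelled output of every plane. Requests. An $f$-cast request is a pair $(\mathbf a,B)$, with $\mathbf a$ an input not involved in any existing request and $B$ a nonempty set of at most $f$ outputs, none of which is involved in an existing request. Routing a (sub)request $(\mathbf a,B')$ on a plane means using on that plane the union of the routes $R(\mathbf a,\mathbf b)$, $\mathbf b\in B'$. On the same plane, routes belonging to different requests (i.e. from different inputs) may not share a link; routes from the same input may. Window algorithm with window size $d^t$. The outputs are divided into $d^{n-t}$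 windows $W_0,\dots,W_{d^{n-t}-1}$ of size $d^t$, each consisting of all outputs sharing a given prefix of length $n-t$. The routing rule is that for every request $(\mathbf a,B)$ and every $w$, the subrequest $(\mathbf a,B\cap W_w)$ is routed entirely on one single plane (different subrequests may use the same or different planes). The network is $f$-cast (wide-sense) nonblocking under the window algorithm if, whenever $f$-cast requests arrive and depart in arbitrary order and all existing requests have been routed following the rule that, for every request $(\mathbf a,B)$ and every $w$, the subrequest $(\mathbf a,B\cap W_w)$ is routed entirely on one single plane, every new $f$-cast request can be routed following the rule without disturbing existing routes. *)

theory Defs
  imports Complex_Main
begin

section \<open>The inverse Banyan network\<close>

text \<open>
  Strings over \<open>\<int>\<^sub>d\<close> are lists of naturals below \<open>d\<close>. Positions in the mathematical text are
  numbered from 1, so position \<open>i\<close> of a string is entry \<open>! (i - 1)\<close> of the list.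
\<close>

type_synonym word = "nat list"

definition words :: "nat \<Rightarrow> nat \<Rightarrow> word set" where
  "words d k = {s. length s = k \<and> set s \<subseteq> {..<d}}"

text \<open>
  Links of one plane: from input \<open>x\<close> to its stage-1 switching element (SE), from the stage-\<open>i\<close> SE
  \<open>z\<close> to the stage-\<open>(i + 1)\<close> SE \<open>z'\<close>, and from a stage-\<open>n\<close> SE to output \<open>y\<close>.
\<close>

datatype link = In_Link word | Stage_Link nat word word | Out_Link word

definition inv_banyan_links :: "nat \<Rightarrow> nat \<Rightarrow> link set" where
  "inv_banyan_links d n =
     In_Link ` words d n \<union>
     {Stage_Link i z z' | i z z'. 1 \<le> i \<and> i < n \<and> z \<in> words d (n - 1) \<and> z' \<in> words d (n - 1) \<and>
        (\<forall>k \<in> {1..n - 1}. k \<noteq> i \<longrightarrow> z' ! (k - 1) = z ! (k - 1))} \<union>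
     Out_Link ` words d n"

text \<open>The SE \<open>y\<^sub>1 \<dots> y\<^bsub>j-1\<^esub> x\<^sub>j \<dots> x\<^bsub>n-1\<^esub>\<close> that the route from \<open>x\<close> to \<open>y\<close> passes at stage \<open>j\<close>.\<close>

definition route_SE :: "nat \<Rightarrow> word \<Rightarrow> word \<Rightarrow> nat \<Rightarrow> word" where
  "route_SE n x y j = take (j - 1) y @ drop (j - 1) (take (n - 1) x)"

definition route :: "nat \<Rightarrow> word \<Rightarrow> word \<Rightarrow> link set" where
  "route n x y =
     {In_Link x} \<union>
     {Stage_Link j (route_SE n x y j) (route_SE n x y (j + 1)) | j. 1 \<le> j \<and> j < n} \<union>
     {Out_Link y}"

text \<open>
  Sanity check: \<^const>\<open>route_SE\<close> is the only way of getting from input \<open>x\<close> to output \<open>y\<close>.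
\<close>

definition SE_path :: "nat \<Rightarrow> nat \<Rightarrow> word \<Rightarrow> word \<Rightarrow> (nat \<Rightarrow> word) \<Rightarrow> bool" where
  "SE_path d n x y p \<longleftrightarrow>
     p 1 = take (n - 1) x \<and> p n = take (n - 1) y \<and>
     (\<forall>j. 1 \<le> j \<and> j < n \<longrightarrow> Stage_Link j (p j) (p (j + 1)) \<in> inv_banyan_links d n)"

lemma length_route_SE:
  assumes "x \<in> words d n" "y \<in> words d n" "1 \<le> j" "j \<le> n"
  shows "length (route_SE n x y j) = n - 1"
  using assms by (auto simp: words_def route_SE_def)

lemma nth_route_SE:
  assumes "x \<in> words d n" "y \<in> words d n" "1 \<le> j" "j \<le> n" "k < n - 1"
  shows "route_SE n x y j ! k = (if k < j - 1 then y ! k else x ! k)"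
  using assms by (auto simp: words_def route_SE_def nth_append)

lemma route_SE_in_words:
  assumes "x \<in> words d n" "y \<in> words d n" "1 \<le> j" "j \<le> n"
  shows "route_SE n x y j \<in> words d (n - 1)"
  using assms length_route_SE[OF assms]
  by (auto simp: words_def route_SE_def dest!: in_set_takeD in_set_dropD)

lemma route_SE_links:
  assumes "x \<in> words d n" "y \<in> words d n" "1 \<le> j" "j < n"
  shows "Stage_Link j (route_SE n x y j) (route_SE n x y (j + 1)) \<in> inv_banyan_links d n"
proof -
  have "\<forall>k \<in> {1..n - 1}. k \<noteq> j \<longrightarrow>
      route_SE n x y (j + 1) ! (k - 1) = route_SE n x y j ! (k - 1)"
    using assms by (auto simp: nth_route_SE)
  then show ?thesis
    using assms route_SE_in_words[of x d n y j] route_SE_in_words[of x d n y "j + 1"]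
    by (auto simp: inv_banyan_links_def)
qed

lemma route_subset_links:
  assumes "x \<in> words d n" "y \<in> words d n"
  shows "route n x y \<subseteq> inv_banyan_links d n"
  using assms route_SE_links by (auto simp: route_def) (auto simp: inv_banyan_links_def)

lemma SE_path_unique:
  assumes n: "1 \<le> n" and x: "x \<in> words d n" and y: "y \<in> words d n"
  shows "SE_path d n x y p \<longleftrightarrow> (\<forall>j \<in> {1..n}. p j = route_SE n x y j)"
proof
  assume p: "SE_path d n x y p"
  have link: "length (p j) = n - 1 \<and> length (p (j + 1)) = n - 1 \<and>
      (\<forall>k < n - 1. k + 1 \<noteq> j \<longrightarrow> p (j + 1) ! k = p j ! k)" if "1 \<le> j" "j < n" for j
  proof -
    have a: "Stage_Link j (p j) (p (j + 1)) \<in> inv_banyan_links d n"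
      using p that by (auto simp: SE_path_def)
    then have *: "\<forall>k \<in> {1..n - 1}. k \<noteq> j \<longrightarrow> p (j + 1) ! (k - 1) = p j ! (k - 1)"
      by (auto simp: inv_banyan_links_def)
    have "p (j + 1) ! k = p j ! k" if "k < n - 1" "k + 1 \<noteq> j" for k
      using bspec[OF *, of "k + 1"] that by auto
    with a show ?thesis by (auto simp: inv_banyan_links_def words_def)
  qed
  have len: "length (p j) = n - 1" if "1 \<le> j" "j \<le> n" for j
  proof (cases "j = n")
    case True
    then show ?thesis using p y by (auto simp: SE_path_def words_def)
  next
    case False
    then show ?thesis using link[of j] that by auto
  qed
  have up: "\<forall>k < n - 1. j - 1 \<le> k \<longrightarrow> p j ! k = x ! k" if "1 \<le> j" "j \<le> n" for j
    using that
  proof (induction j rule: nat_induct_at_least)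
    case base
    then show ?case using p by (auto simp: SE_path_def)
  next
    case (Suc j)
    then show ?case using link[of j] by auto
  qed
  have down: "\<forall>k < n - 1. k < j - 1 \<longrightarrow> p j ! k = y ! k" if "j \<le> n" "1 \<le> j" for j
    using that
  proof (induction j rule: inc_induct)
    case base
    then show ?case using p by (auto simp: SE_path_def)
  next
    case (step j)
    then show ?case using link[of j] by auto
  qed
  show "\<forall>j \<in> {1..n}. p j = route_SE n x y j"
  proof
    fix j assume "j \<in> {1..n}"
    then show "p j = route_SE n x y j"
      using up[of j] down[of j] len[of j] x y
      by (auto intro!: nth_equalityI simp: length_route_SE nth_route_SE)
  qed
next
  assume "\<forall>j \<in> {1..n}. p j = route_SE n x y j"
  moreover have "route_SE n x y 1 = take (n - 1) x" "route_SE n x y n = take (n - 1) y"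
    using x y by (auto simp: route_SE_def words_def)
  ultimately show "SE_path d n x y p"
    using n x y route_SE_links[OF x y] by (auto simp: SE_path_def)
qed


section \<open>Requests and the window algorithm on the multi-plane network\<close>

text \<open>
  A routed request \<open>(a, B)\<close>: for every \<open>b \<in> B\<close> the route from \<open>a\<close> to \<open>b\<close> is set up on plane
  \<open>plane_of c b\<close>. Values of \<^term>\<open>plane_of c\<close> outside \<^term>\<open>dests c\<close> play no role.
\<close>

datatype connection = Connection (source: word) (dests: "word set") (plane_of: "word \<Rightarrow> nat")

definition used_links :: "nat \<Rightarrow> connection \<Rightarrow> (nat \<times> link) set" where
  "used_links n c = {(plane_of c b, l) | b l. b \<in> dests c \<and> l \<in> route n (source c) b}"

text \<open>
  The windows of size \<open>d ^ t\<close> are indexed by the common prefix \<open>w\<close>, of length \<open>n - t\<close>, of their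
  members.
\<close>

definition window :: "nat \<Rightarrow> nat \<Rightarrow> nat \<Rightarrow> word \<Rightarrow> word set" where
  "window d n t w = {y \<in> words d n. take (n - t) y = w}"

definition window_rule :: "nat \<Rightarrow> nat \<Rightarrow> nat \<Rightarrow> connection \<Rightarrow> bool" where
  "window_rule d n t c \<longleftrightarrow>
     (\<forall>w \<in> words d (n - t). \<exists>p. \<forall>b \<in> dests c \<inter> window d n t w. plane_of c b = p)"

text \<open>
  A state of the network is the set of its existing routed requests.
\<close>

definition fcast_request :: "nat \<Rightarrow> nat \<Rightarrow> nat \<Rightarrow> connection set \<Rightarrow> word \<Rightarrow> word set \<Rightarrow> bool" where
  "fcast_request d n f S a B \<longleftrightarrow>
     a \<in> words d n \<and> B \<subseteq> words d n \<and> B \<noteq> {} \<and> card B \<le> f \<and>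
     (\<forall>c \<in> S. source c \<noteq> a \<and> dests c \<inter> B = {})"

definition routable :: "nat \<Rightarrow> nat \<Rightarrow> nat \<Rightarrow> nat \<Rightarrow> connection set \<Rightarrow> connection \<Rightarrow> bool" where
  "routable d n m t S c \<longleftrightarrow>
     (\<forall>b \<in> dests c. plane_of c b < m) \<and>
     window_rule d n t c \<and>
     (\<forall>c' \<in> S. used_links n c \<inter> used_links n c' = {})"

inductive reachable :: "nat \<Rightarrow> nat \<Rightarrow> nat \<Rightarrow> nat \<Rightarrow> nat \<Rightarrow> connection set \<Rightarrow> bool"
  for d n m t f where
  empty: "reachable d n m t f {}"
| arrive: "reachable d n m t f S \<Longrightarrow> fcast_request d n f S (source c) (dests c) \<Longrightarrow>
    routable d n m t S c \<Longrightarrow> reachable d n m t f (insert c S)"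
| depart: "reachable d n m t f S \<Longrightarrow> c \<in> S \<Longrightarrow> reachable d n m t f (S - {c})"

definition window_nonblocking :: "nat \<Rightarrow> nat \<Rightarrow> nat \<Rightarrow> nat \<Rightarrow> nat \<Rightarrow> bool" where
  "window_nonblocking d n m t f \<longleftrightarrow>
     (\<forall>S a B. reachable d n m t f S \<longrightarrow> fcast_request d n f S a B \<longrightarrow>
        (\<exists>c. source c = a \<and> dests c = B \<and> routable d n m t S c))"


section \<open>The bound on the number of planes\<close>

text \<open>
  The bound is real-valued: \<open>2 * t - n - 1\<close> is negative, and the bound not an integer, when \<open>t\<close>
  is close to \<open>n / 2\<close>. All exponents are therefore integers, used with \<open>powi\<close>.
  Of the five cases, each \<open>else\<close> condition is the negation of the preceding one over the
  integers; in the last one, \<open>r \<le> n - t - 1\<close> and \<open>r \<le> 2 * t - n - 2\<close>.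
\<close>

definition window_bound :: "nat \<Rightarrow> nat \<Rightarrow> nat \<Rightarrow> nat \<Rightarrow> real" where
  "window_bound d n t f =
    (let D = real d; F = real f; n' = int n; t' = int t;
         r = \<lfloor>log (real d) (real f)\<rfloor>;
         h = \<lceil>real_of_int (n' - r) / 2\<rceil>;
         g = \<lfloor>real_of_int (n' + r) / 2\<rfloor>
     in
       if t' < \<lfloor>real n / 2\<rfloor> then
         if r \<le> n' - 2 * t' - 1
         then F * (D powi (h - 1) - 1) + D powi (n' - h) - 1
         else real t * (D - 1) * D powi (n' - t' - 1) + D powi (n' - 2 * t' - 1) - 1
       else
         if r \<ge> n' - t'
         then ((real n - real t - 1) * (D - 1) - 1) * D powi (n' - t' - 1)
              + D powi t' - (D - 1) * D powi (2 * t' - n' - 1)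
         else if 2 * t' - n' - 2 < r
         then F * (D powi (n' - t' - r - 1) - 1) + (of_int r * (D - 1) - 1) * D powi (n' - t' - 1)
              + D powi (n' - t' - r - 1) + D powi t' - (D - 1) * D powi (2 * t' - n' - 1)
         else F * (D powi (n' - t' - r - 1) - 1) + (of_int r * (D - 1) - 1) * D powi (n' - t' - 1)
              + D powi g + F * (D powi (n' - g - 1) - 1))"

end

theory Submission
  imports Defs
begin

text \<open>
  Fix a new request \<open>(a, B)\<close> and a window \<open>w\<close>. A route from \<open>x\<close> to \<open>y\<close> meets a route from \<open>a\<close> to
  \<open>b\<close> iff for some \<open>1 \<le> j < n\<close> the inputs agree in positions \<open>j, \<dots>, n - 1\<close> (\<open>d ^ j - 1\<close>
  candidates \<open>x\<close>, the set \<open>A j\<close>) and the outputs share a prefix of length \<open>j\<close>. A plane blocked for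
  \<open>(a, B \<inter> W\<^sub>w)\<close> is thus charged to a pair (input, window) with a blocking route. If the
  window has a common prefix of length exactly \<open>l < n - t\<close> with \<open>w\<close>, the input must lie in \<open>A l\<close>.
  The pairs are counted in three ways: those with an input in a small \<open>A J\<close> by the fanout,
  at most \<open>f\<close> each; those with \<open>J < l < h\<close> as a product of inputs and windows; the others by the
  number of outputs with prefix of length \<open>h\<close> in common with \<open>w\<close>. Within \<open>W\<^sub>w\<close> itself the last
  count is refined by a second threshold \<open>g\<close>: inputs in \<open>A g\<close> count once, and any other blocking
  output shares a prefix of length \<open>g + 1\<close> with an element of \<open>B\<close>. The cases of the bound are
  choices of \<open>J\<close>, \<open>h\<close> and \<open>g\<close>.
\<close>

section \<open>Counting words with a prescribed prefix\<close>

lemma finite_words: "finite (words d k)"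
proof -
  have "words d k = {xs. set xs \<subseteq> {..<d} \<and> length xs = k}"
    by (auto simp: words_def)
  then show ?thesis
    by (simp add: finite_lists_length_eq)
qed

lemma card_words: "card (words d k) = d ^ k"
proof -
  have "words d k = {xs. set xs \<subseteq> {..<d} \<and> length xs = k}"
    by (auto simp: words_def)
  then show ?thesis
    by (simp add: card_lists_length_eq)
qed

lemma take_in_words: "y \<in> words d n \<Longrightarrow> j \<le> n \<Longrightarrow> take j y \<in> words d j"
  by (auto simp: words_def dest: in_set_takeD)

lemma drop_in_words: "y \<in> words d n \<Longrightarrow> drop j y \<in> words d (n - j)"
  by (auto simp: words_def dest: in_set_dropD)

lemma append_in_words: "u \<in> words d i \<Longrightarrow> v \<in> words d j \<Longrightarrow> u @ v \<in> words d (i + j)"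
  by (auto simp: words_def)

lemma card_words_prefix:
  assumes "u \<in> words d j" "j \<le> n"
  shows "card {y \<in> words d n. take j y = u} = d ^ (n - j)"
proof -
  have "{y \<in> words d n. take j y = u} = (\<lambda>v. u @ v) ` words d (n - j)" (is "?L = ?R")
  proof
    show "?L \<subseteq> ?R"
    proof
      fix y assume "y \<in> ?L"
      then have "y = u @ drop j y" "drop j y \<in> words d (n - j)"
        by (auto simp: drop_in_words)
      then show "y \<in> ?R" by blast
    qed
    show "?R \<subseteq> ?L"
      using assms append_in_words[OF assms(1)] by (fastforce simp: words_def)
  qed
  moreover have "inj_on (\<lambda>v. u @ v) (words d (n - j))"
    by (simp add: inj_on_def)
  ultimately show ?thesis
    by (simp add: card_image card_words)
qed

text \<open>Prefix classes are nested, so their sizes subtract. Applied to windows, this counts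
  those that branch off from \<open>w\<close> right after position \<open>l\<close>.\<close>

lemma card_words_prefix_diff:
  assumes "u \<in> words d k" "l < k"
  shows "card {v \<in> words d k. take l v = take l u \<and> take (Suc l) v \<noteq> take (Suc l) u}
    = d ^ (k - l) - d ^ (k - l - 1)"
proof -
  let ?P = "\<lambda>j. {v \<in> words d k. take j v = take j u}"
  have "?P (Suc l) \<subseteq> ?P l"
    by clarsimp (metis lessI less_imp_le min.absorb1 take_take)
  moreover have "finite (?P (Suc l))"
    by (simp add: finite_words)
  ultimately have "card (?P l - ?P (Suc l)) = d ^ (k - l) - d ^ (k - l - 1)"
    using card_words_prefix[OF take_in_words[OF assms(1)], of l k]
      card_words_prefix[OF take_in_words[OF assms(1)], of "Suc l" k] assms(2)
    by (simp add: card_Diff_subset)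
  moreover have "?P l - ?P (Suc l) =
      {v \<in> words d k. take l v = take l u \<and> take (Suc l) v \<noteq> take (Suc l) u}"
    by auto
  ultimately show ?thesis by simp
qed

section \<open>Inputs able to merge with a given input, and where two routes meet\<close>

text \<open>
  The other inputs whose routes can share with a route of \<open>a\<close> a link leaving one of the
  stages \<open>1, \<dots>, j\<close>. There is none for \<open>j = 0\<close>, which the guard \<open>1 \<le> j\<close> enforces since
  \<open>0 - 1 = 0\<close>.
\<close>

definition merging_inputs :: "nat \<Rightarrow> nat \<Rightarrow> word \<Rightarrow> nat \<Rightarrow> word set" where
  "merging_inputs d n a j = {x \<in> words d n. x \<noteq> a \<and> 1 \<le> j \<and>
     drop (j - 1) (take (n - 1) x) = drop (j - 1) (take (n - 1) a)}"

lemma finite_merging_inputs: "finite (merging_inputs d n a j)"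
  by (simp add: merging_inputs_def finite_words)

lemma merging_inputs_mono:
  assumes "i \<le> j"
  shows "merging_inputs d n a i \<subseteq> merging_inputs d n a j"
proof
  fix x assume x: "x \<in> merging_inputs d n a i"
  \<comment> \<open>Membership includes \<open>1 \<le> i\<close>, so the truncated subtractions are
    exact here.\<close>
  then have "j - 1 = (j - i) + (i - 1)"
    using assms by (simp add: merging_inputs_def)
  then have "drop (j - 1) z = drop (j - i) (drop (i - 1) z)" for z :: word
    by simp
  then have "drop (j - 1) (take (n - 1) x) = drop (j - 1) (take (n - 1) a)"
    using x by (simp add: merging_inputs_def del: drop_drop)
  then show "x \<in> merging_inputs d n a j"
    using x assms by (simp add: merging_inputs_def)
qed

text \<open>Only the block \<open>mid\<close> of length \<open>n - j\<close> is prescribed: the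
  first \<open>j - 1\<close> letters and the last one are free, which leaves \<open>d ^ j\<close>
  words, and \<open>a\<close> itself is removed. For \<open>j = 0\<close> both sides vanish.\<close>

lemma card_merging_inputs:
  assumes a: "a \<in> words d n" and "j \<le> n"
  shows "card (merging_inputs d n a j) = d ^ j - 1"
proof (cases "j = 0")
  case True
  then show ?thesis by (simp add: merging_inputs_def)
next
  case False
  then have j: "1 \<le> j" by simp
  define mid where "mid = drop (j - 1) (take (n - 1) a)"
  let ?X = "{x \<in> words d n. drop (j - 1) (take (n - 1) x) = mid}"
  let ?g = "\<lambda>(u, v). u @ mid @ v"
  have mid: "mid \<in> words d (n - j)"
    using drop_in_words[OF take_in_words[OF a, of "n - 1"], of "j - 1"] j by (simp add: mid_def)
  have "?X = ?g ` (words d (j - 1) \<times> words d 1)"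
  proof
    show "?X \<subseteq> ?g ` (words d (j - 1) \<times> words d 1)"
    proof
      fix x assume x: "x \<in> ?X"
      then have "length x = n" by (simp add: words_def)
      then have "take (n - 1) x = take (j - 1) x @ mid"
        using x j assms(2) append_take_drop_id[of "j - 1" "take (n - 1) x"]
        by (simp add: min_def del: append_take_drop_id split: if_splits)
      then have "x = ?g (take (j - 1) x, drop (n - 1) x)"
        using append_take_drop_id[of "n - 1" x] by simp
      moreover have "drop (n - 1) x \<in> words d 1" "take (j - 1) x \<in> words d (j - 1)"
        using x drop_in_words[of x d n "n - 1"] take_in_words[of x d n "j - 1"] j assms(2) by auto
      ultimately show "x \<in> ?g ` (words d (j - 1) \<times> words d 1)" by blast
    qed
    show "?g ` (words d (j - 1) \<times> words d 1) \<subseteq> ?X"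
    proof
      fix x assume "x \<in> ?g ` (words d (j - 1) \<times> words d 1)"
      then obtain u v where uv: "u \<in> words d (j - 1)" "v \<in> words d 1" "x = u @ mid @ v" by auto
      then have "x \<in> words d n"
        using append_in_words[OF uv(1) append_in_words[OF mid uv(2)]] j assms(2) by simp
      moreover have "take (n - 1) x = u @ mid"
        using uv mid j assms(2) by (auto simp: words_def)
      ultimately show "x \<in> ?X"
        using uv by (simp add: words_def)
    qed
  qed
  moreover have "inj_on ?g (words d (j - 1) \<times> words d 1)"
    by (auto simp: inj_on_def words_def)
  ultimately have "card ?X = d ^ (j - 1) * d ^ 1"
    by (simp only: card_image card_cartesian_product card_words)
  also have "\<dots> = d ^ j"
    using j by (simp flip: power_Suc2)
  finally have "card ?X = d ^ j" .
  moreover have "merging_inputs d n a j = ?X - {a}"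
    using j by (auto simp: merging_inputs_def mid_def)
  ultimately show ?thesis
    using a by (simp add: mid_def)
qed

text \<open>Distinct inputs and distinct outputs rule out a common outer link, so a link between two
  stages is shared. Its first SE shows the agreement of the inputs, its second one the common output
  prefix.\<close>

lemma route_Int:
  assumes x: "x \<in> words d n" "x' \<in> words d n" and y: "y \<in> words d n" "y' \<in> words d n"
    and ne: "x' \<noteq> x" "y' \<noteq> y" and meet: "route n x y \<inter> route n x' y' \<noteq> {}"
  shows "\<exists>j. 1 \<le> j \<and> j < n \<and> x' \<in> merging_inputs d n x j \<and> take j y' = take j y"
proof -
  obtain j where j: "1 \<le> j" "j < n"
    and SE: "route_SE n x y j = route_SE n x' y' j"
      "route_SE n x y (j + 1) = route_SE n x' y' (j + 1)"
    using meet ne by (auto simp: route_def)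
  have "drop (j - 1) (take (n - 1) x') = drop (j - 1) (take (n - 1) x)"
    using SE(1) y j by (auto simp: route_SE_def words_def)
  moreover have "take j y' = take j y"
    using SE(2) y j by (auto simp: route_SE_def words_def)
  ultimately show ?thesis
    using x ne j by (auto simp: merging_inputs_def)
qed

text \<open>The sum telescopes: the summand for \<open>l = J + s + 1\<close> equals
  \<open>(d - 1) * d ^ L\<close> plus the change of \<open>d ^ (L - s)\<close> when \<open>s\<close>
  grows by one.\<close>

lemma layer_sum:
  fixes d J L s :: nat
  assumes d: "d \<ge> 1" and "J + s \<le> L"
  shows "real (\<Sum>l = Suc J..<Suc (J + s). (d ^ l - d ^ J) * (d ^ (Suc L - l) - d ^ (Suc L - l - 1)))
    = real s * (real d - 1) * real d ^ L - real d ^ L + real d ^ (L - s)"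
  using assms(2)
proof (induction s)
  case 0
  then show ?case by simp
next
  case (Suc s)
  let ?D = "real d"
  \<comment> \<open>With \<open>p\<close> every exponent becomes a sum, so that no truncated
    subtraction is left in the algebra.\<close>
  define l p where "l = Suc (J + s)" and "p = L - l"
  have L: "L = l + p" "L - s = J + Suc p" "L - Suc s = J + p"
    using Suc.prems by (simp_all add: l_def p_def)
  have "d ^ J \<le> d ^ l" "d ^ p \<le> d ^ Suc p"
    using d by (auto simp: l_def intro!: power_increasing simp del: power_Suc)
  then have "real ((d ^ l - d ^ J) * (d ^ (Suc L - l) - d ^ (Suc L - l - 1)))
      = (?D ^ l - ?D ^ J) * (?D ^ Suc p - ?D ^ p)"
    by (simp add: L of_nat_diff)
  also have "\<dots> = (?D - 1) * ?D ^ L - ?D ^ (J + Suc p) + ?D ^ (J + p)"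
    by (simp add: L power_add algebra_simps)
  finally have "real ((d ^ l - d ^ J) * (d ^ (Suc L - l) - d ^ (Suc L - l - 1)))
      = (?D - 1) * ?D ^ L - ?D ^ (L - s) + ?D ^ (L - Suc s)"
    by (simp only: L(2,3))
  moreover have "{Suc J..<Suc (J + Suc s)} = insert l {Suc J..<l}"
    by (auto simp: l_def)
  ultimately show ?case
    using Suc.IH Suc.prems by (simp add: l_def algebra_simps del: diff_Suc_1)
qed

section \<open>Planes blocked for one subrequest\<close>

text \<open>
  A subrequest \<open>(a, B)\<close> within the window \<open>w\<close>, and the set \<open>Y\<close> of the outputs of existing routes
  that meet a route of this subrequest on their plane.
\<close>

locale blocked_subrequest =
  fixes d n t f :: nat and a w :: word and B Y :: "word set"
    and src :: "word \<Rightarrow> word" and plane :: "word \<Rightarrow> nat"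
  assumes d: "d \<ge> 1" and t: "t < n"
    and a: "a \<in> words d n" and w: "w \<in> words d (n - t)"
    and B: "B \<subseteq> window d n t w" "B \<noteq> {}" "card B \<le> f"
    and Y: "Y \<subseteq> words d n" "Y \<inter> B = {}"
    and fanout: "\<And>x. card {y \<in> Y. src y = x} \<le> f"
    and one_plane: "\<And>y y'. y \<in> Y \<Longrightarrow> y' \<in> Y \<Longrightarrow> src y = src y' \<Longrightarrow>
      take (n - t) y = take (n - t) y' \<Longrightarrow> plane y = plane y'"
    and blocking: "\<And>y. y \<in> Y \<Longrightarrow> \<exists>j b. 1 \<le> j \<and> j < n \<and> src y \<in> merging_inputs d n a j \<and>
      b \<in> B \<and> take j y = take j b"
begin

abbreviation "A \<equiv> merging_inputs d n a"

lemma finite_Y: "finite Y"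
  using Y finite_subset finite_words by blast

lemma finite_B: "finite B"
  using B finite_subset[OF _ finite_words[of d n]] by (auto simp: window_def)

lemma card_plane_le: "Z \<subseteq> Y \<Longrightarrow> card (plane ` Z) \<le> card Z"
  by (meson card_image_le finite_Y finite_subset)

text \<open>By \<open>one_plane\<close> the plane is a function of the pair (input, window), so
  pairs can be counted in place of outputs.\<close>

lemma card_plane_le_keys:
  assumes "Z \<subseteq> Y" "finite K" "\<And>y. y \<in> Z \<Longrightarrow> (src y, take (n - t) y) \<in> K"
  shows "card (plane ` Z) \<le> card K"
proof -
  let ?key = "\<lambda>y. (src y, take (n - t) y)"
  \<comment> \<open>\<open>inv_into\<close> picks a representative output of each key; it need not
    be \<open>y\<close>, but lies on the same plane.\<close>
  have *: "inv_into Z ?key (?key y) \<in> Z" "?key (inv_into Z ?key (?key y)) = ?key y" if "y \<in> Z" for y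
    using that inv_into_into[of "?key y" ?key Z] f_inv_into_f[of "?key y" ?key Z] by blast+
  have "plane y = (plane \<circ> inv_into Z ?key) (?key y)" if "y \<in> Z" for y
    using one_plane[of y "inv_into Z ?key (?key y)"] *[OF that] that assms(1) by auto
  then have "plane ` Z \<subseteq> (plane \<circ> inv_into Z ?key) ` K"
    using assms(3) by blast
  then show ?thesis
    using assms(2) by (rule surj_card_le[rotated])
qed

lemma card_A_Diff:
  assumes "i \<le> j" "j \<le> n"
  shows "card (A j - A i) = d ^ j - d ^ i"
  using assms merging_inputs_mono[OF assms(1)] d
  by (simp add: card_Diff_subset finite_merging_inputs card_merging_inputs[OF a])

lemma card_near_input:
  assumes "J \<le> n"
  shows "card (plane ` {y \<in> Y. src y \<in> A J}) \<le> f * (d ^ J - 1)"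
proof -
  have "{y \<in> Y. src y \<in> A J} = (\<Union>x \<in> A J. {y \<in> Y. src y = x})" by auto
  then have "card {y \<in> Y. src y \<in> A J} \<le> (\<Sum>x \<in> A J. card {y \<in> Y. src y = x})"
    by (simp add: card_UN_le finite_merging_inputs)
  also have "\<dots> \<le> (\<Sum>x \<in> A J. f)"
    using fanout by (rule sum_mono)
  also have "\<dots> = f * (d ^ J - 1)"
    by (simp add: card_merging_inputs[OF a assms])
  finally show ?thesis
    using card_plane_le[of "{y \<in> Y. src y \<in> A J}"] by simp
qed

text \<open>Since \<open>w\<close> has length \<open>n - t\<close>, \<open>near (n - t)\<close> is
  the part of \<open>Y\<close> inside the window of the subrequest.\<close>

definition near :: "nat \<Rightarrow> word set" where
  "near h = {y \<in> Y. take h y = take h w}"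

definition layer :: "nat \<Rightarrow> word set" where
  "layer l = {y \<in> Y. take l y = take l w \<and> take (Suc l) y \<noteq> take (Suc l) w}"

lemma near_or_layer: "y \<in> Y \<Longrightarrow> y \<in> near h \<or> (\<exists>l < h. y \<in> layer l)"
  by (induction h) (auto simp: near_def layer_def less_Suc_eq)

lemma take_B: "b \<in> B \<Longrightarrow> j \<le> n - t \<Longrightarrow> take j b = take j w"
  using B by (auto simp: window_def min_def)

text \<open>All of \<open>B\<close> starts with \<open>w\<close>, so a prefix shared with an element
  of \<open>B\<close> cannot extend past the place where \<open>y\<close> leaves \<open>w\<close>.
  Hence \<open>j \<le> l\<close>, and monotonicity of \<open>A\<close> does the rest.\<close>

lemma layer_src:
  assumes y: "y \<in> layer l" and l: "l < n - t"
  shows "src y \<in> A l"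
proof -
  obtain j b where jb: "1 \<le> j" "src y \<in> A j" "b \<in> B" "take j y = take j b"
    using blocking[of y] y by (auto simp: layer_def)
  have "j \<le> l"
  proof (rule ccontr)
    assume "\<not> j \<le> l"
    then have "take (Suc l) y = take (Suc l) b"
      using jb(4) by (metis Suc_leI linorder_not_le min.absorb1 take_take)
    then show False
      using take_B[OF jb(3), of "Suc l"] y l by (simp add: layer_def)
  qed
  then show ?thesis
    using jb(2) merging_inputs_mono by blast
qed

lemma card_layer:
  assumes "J \<le> l" "l < n - t"
  shows "card (plane ` {y \<in> layer l. src y \<notin> A J})
    \<le> (d ^ l - d ^ J) * (d ^ (n - t - l) - d ^ (n - t - l - 1))"
proof -
  let ?K = "{v \<in> words d (n - t). take l v = take l w \<and> take (Suc l) v \<noteq> take (Suc l) w}"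
  have "card (plane ` {y \<in> layer l. src y \<notin> A J}) \<le> card ((A l - A J) \<times> ?K)"
  proof (rule card_plane_le_keys)
    show "{y \<in> layer l. src y \<notin> A J} \<subseteq> Y" by (auto simp: layer_def)
    show "finite ((A l - A J) \<times> ?K)" by (simp add: finite_merging_inputs finite_words)
    fix y assume y: "y \<in> {y \<in> layer l. src y \<notin> A J}"
    then have "take (n - t) y \<in> words d (n - t)"
      using Y by (auto simp: layer_def intro: take_in_words)
    then show "(src y, take (n - t) y) \<in> (A l - A J) \<times> ?K"
      using y layer_src[of y l] assms(2) by (auto simp: layer_def min_def)
  qed
  then show ?thesis
    using assms by (simp add: card_cartesian_product card_A_Diff card_words_prefix_diff[OF w])
qed

text \<open>The sum can start at \<open>Suc J\<close>: by \<open>layer_src\<close> the inputs of the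
  layers \<open>l \<le> J\<close> lie in \<open>A l\<close>, hence in \<open>A J\<close>, and are
  already paid for by the fanout term.\<close>

lemma card_planes:
  assumes "J < h" "h \<le> n - t"
  shows "card (plane ` Y) \<le> f * (d ^ J - 1)
    + (\<Sum>l = Suc J..<h. (d ^ l - d ^ J) * (d ^ (n - t - l) - d ^ (n - t - l - 1)))
    + card (plane ` {y \<in> near h. src y \<notin> A J})"
proof -
  let ?L = "\<lambda>l. {y \<in> layer l. src y \<notin> A J}"
  have "Y \<subseteq> {y \<in> Y. src y \<in> A J} \<union> (\<Union>l \<in> {Suc J..<h}. ?L l) \<union> {y \<in> near h. src y \<notin> A J}"
  proof
    fix y assume y: "y \<in> Y"
    have J_less: "J < l" if "y \<in> layer l" "l < h" "src y \<notin> A J" for l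
    proof (rule ccontr)
      assume "\<not> J < l"
      then have "A l \<subseteq> A J" by (intro merging_inputs_mono) simp
      then show False
        using that layer_src[of y l] assms(2) by auto
    qed
    have "y \<in> (\<Union>l \<in> {Suc J..<h}. ?L l)" if "y \<in> layer l" "l < h" "src y \<notin> A J" for l
      using that J_less[OF that] by (intro UN_I[of l]) auto
    then show "y \<in> {y \<in> Y. src y \<in> A J} \<union> (\<Union>l \<in> {Suc J..<h}. ?L l) \<union> {y \<in> near h. src y \<notin> A J}"
      using y near_or_layer[OF y, of h] by blast
  qed
  from image_mono[OF this, of plane]
  have "plane ` Y \<subseteq> plane ` {y \<in> Y. src y \<in> A J} \<union> (\<Union>l \<in> {Suc J..<h}. plane ` ?L l)
      \<union> plane ` {y \<in> near h. src y \<notin> A J}" (is "_ \<subseteq> ?P \<union> ?Q \<union> ?R")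
    by (simp only: image_Un image_UN)
  moreover have "finite (plane ` Z)" if "Z \<subseteq> Y" for Z
    using that finite_Y finite_subset by blast
  then have "finite (?P \<union> ?Q \<union> ?R)"
    by (intro finite_UnI finite_UN_I) (auto simp: layer_def near_def)
  ultimately have "card (plane ` Y) \<le> card (?P \<union> ?Q \<union> ?R)"
    by (rule card_mono[rotated])
  moreover have "card (?P \<union> ?Q \<union> ?R) \<le> card ?P + card ?Q + card ?R"
    using card_Un_le[of "?P \<union> ?Q" ?R] card_Un_le[of ?P ?Q] by linarith
  moreover have "card ?Q \<le> (\<Sum>l = Suc J..<h. card (plane ` ?L l))"
    by (rule card_UN_le) simp
  moreover have "\<dots> \<le> (\<Sum>l = Suc J..<h. (d ^ l - d ^ J) * (d ^ (n - t - l) - d ^ (n - t - l - 1)))"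
    using assms by (intro sum_mono card_layer) auto
  moreover have "card ?P \<le> f * (d ^ J - 1)"
    using assms by (intro card_near_input) auto
  ultimately show ?thesis by linarith
qed

text \<open>The outputs in \<open>B\<close> share this prefix but are not in \<open>Y\<close>, hence
  the subtraction.\<close>

lemma card_near:
  assumes "h \<le> n - t"
  shows "card (plane ` {y \<in> near h. src y \<notin> A J}) \<le> d ^ (n - h) - card B"
proof -
  let ?W = "{y \<in> words d n. take h y = take h w}"
  have "B \<subseteq> ?W"
    using B(1) take_B assms by (auto simp: window_def)
  moreover have "card ?W = d ^ (n - h)"
    using assms take_in_words[OF w assms] by (intro card_words_prefix) auto
  ultimately have "card (?W - B) = d ^ (n - h) - card B"
    by (simp add: card_Diff_subset finite_B)
  moreover have "card {y \<in> near h. src y \<notin> A J} \<le> card (?W - B)"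
    using Y by (intro card_mono) (auto simp: near_def finite_words)
  ultimately show ?thesis
    using card_plane_le[of "{y \<in> near h. src y \<notin> A J}"] by (auto simp: near_def)
qed

lemma card_near_window:
  assumes "J \<le> g" "g < n"
  shows "card (plane ` {y \<in> near (n - t). src y \<notin> A J})
    \<le> (d ^ g - d ^ J) + card B * (d ^ (n - g - 1) - 1)"
proof -
  let ?Z = "{y \<in> near (n - t). src y \<notin> A J}"
  let ?Z1 = "{y \<in> ?Z. src y \<in> A g}" and ?Z2 = "{y \<in> ?Z. src y \<notin> A g}"
  let ?W = "\<lambda>b. {y \<in> words d n. take (Suc g) y = take (Suc g) b}"
  \<comment> \<open>All these outputs lie in the one window \<open>w\<close>, so each input accounts
    for a single plane.\<close>
  have "card (plane ` ?Z1) \<le> card ((A g - A J) \<times> {w})"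
    using w by (intro card_plane_le_keys) (auto simp: near_def finite_merging_inputs words_def)
  then have 1: "card (plane ` ?Z1) \<le> d ^ g - d ^ J"
    using assms by (simp add: card_cartesian_product card_A_Diff)
  have "?Z2 \<subseteq> (\<Union>b \<in> B. ?W b - {b})"
  proof
    fix y assume y: "y \<in> ?Z2"
    then obtain j b where jb: "src y \<in> A j" "b \<in> B" "take j y = take j b" "y \<in> Y"
      using blocking[of y] by (auto simp: near_def)
    \<comment> \<open>Otherwise monotonicity would put the input into \<open>A g\<close>.\<close>
    have "Suc g \<le> j"
      using y jb(1) merging_inputs_mono[of j g] by fastforce
    then have "take (Suc g) y = take (Suc g) b"
      using jb(3) by (metis min.absorb1 take_take)
    then show "y \<in> (\<Union>b \<in> B. ?W b - {b})"
      using jb Y by auto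
  qed
  then have "card ?Z2 \<le> card (\<Union>b \<in> B. ?W b - {b})"
    by (intro card_mono) (auto simp: finite_B finite_words)
  also have "\<dots> \<le> (\<Sum>b \<in> B. card (?W b - {b}))"
    by (simp add: card_UN_le finite_B)
  also have "\<dots> = (\<Sum>b \<in> B. d ^ (n - g - 1) - 1)"
  proof (rule sum.cong)
    fix b assume "b \<in> B"
    then have b: "b \<in> words d n"
      using B by (auto simp: window_def)
    then have "card (?W b) = d ^ (n - g - 1)"
      using assms card_words_prefix[OF take_in_words[OF b, of "Suc g"], of n] by simp
    then show "card (?W b - {b}) = d ^ (n - g - 1) - 1"
      using b by simp
  qed simp
  finally have 2: "card ?Z2 \<le> card B * (d ^ (n - g - 1) - 1)" by simp
  have "plane ` ?Z = plane ` ?Z1 \<union> plane ` ?Z2" by blast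
  then have "card (plane ` ?Z) \<le> card (plane ` ?Z1) + card (plane ` ?Z2)"
    by (simp add: card_Un_le)
  moreover have "card (plane ` ?Z2) \<le> card ?Z2"
    by (rule card_plane_le) (auto simp: near_def)
  ultimately show ?thesis
    using 1 2 by linarith
qed

text \<open>Here \<open>h = J + s + 1\<close>, so \<open>s\<close> is the number of layers counted
  as products.\<close>

lemma card_planes_real:
  assumes "J + s < n - t"
  shows "real (card (plane ` Y)) \<le> real f * (real d ^ J - 1)
    + real s * (real d - 1) * real d ^ (n - t - 1) - real d ^ (n - t - 1) + real d ^ (n - t - 1 - s)
    + real (card (plane ` {y \<in> near (Suc (J + s)). src y \<notin> A J}))"
proof -
  define L where "L = n - t - 1"
  have L: "n - t = Suc L" "J + s \<le> L"
    using assms by (auto simp: L_def)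
  have "real (card (plane ` Y)) \<le> real (f * (d ^ J - 1))
    + real (\<Sum>l = Suc J..<Suc (J + s). (d ^ l - d ^ J) * (d ^ (Suc L - l) - d ^ (Suc L - l - 1)))
    + real (card (plane ` {y \<in> near (Suc (J + s)). src y \<notin> A J}))"
    using card_planes[of J "Suc (J + s)"] assms unfolding L(1)
    by (simp only: of_nat_le_iff flip: of_nat_add)
  also have "real (f * (d ^ J - 1)) = real f * (real d ^ J - 1)"
    using d by (simp add: of_nat_diff)
  finally show ?thesis
    unfolding layer_sum[OF d L(2)] by (simp add: L_def)
qed

lemma card_B_pos: "1 \<le> card B"
  using B(2) finite_B by (simp add: Suc_le_eq card_gt_0_iff)

lemma card_near_real:
  assumes "h \<le> n - t"
  shows "real (card (plane ` {y \<in> near h. src y \<notin> A J})) \<le> real d ^ (n - h) - 1"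
proof -
  have "card (plane ` {y \<in> near h. src y \<notin> A J}) \<le> d ^ (n - h) - 1"
    using card_near[OF assms, of J] card_B_pos by linarith
  then have "real (card (plane ` {y \<in> near h. src y \<notin> A J})) \<le> real (d ^ (n - h) - 1)"
    by (simp only: of_nat_le_iff)
  then show ?thesis
    using d by (simp add: of_nat_diff)
qed

text \<open>
  The threshold \<open>g = t - 1\<close> gives \<open>d ^ (t - 1) + |B| (d ^ (n - t) - 1)\<close>, counting all outputs of
  the window gives \<open>d ^ t - |B|\<close>; the two cross at \<open>|B| = (d - 1) d ^ (2 t - n - 1)\<close>.
\<close>

lemma card_window_nat:
  assumes d2: "d \<ge> 2" and J: "J < n - t" and t2: "n + 1 \<le> 2 * t"
  shows "card (plane ` {y \<in> near (n - t). src y \<notin> A J}) + (d - 1) * d ^ (2 * t - n - 1) < d ^ t"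
proof -
  let ?X = "card (plane ` {y \<in> near (n - t). src y \<notin> A J})"
  define e c where "e = 2 * t - n - 1" and "c = (d - 1) * d ^ e"
  have c_mult: "c * d ^ (n - t) + d ^ (t - 1) = d ^ t"
  proof -
    have "e + (n - t) = t - 1" "t = Suc (t - 1)"
      using t2 t by (auto simp: e_def)
    then have "d ^ e * d ^ (n - t) = d ^ (t - 1)" "d ^ t = d * d ^ (t - 1)"
      by (metis power_add) (metis \<open>t = Suc (t - 1)\<close> power_Suc)
    then show ?thesis
      using d by (cases d) (simp_all add: c_def)
  qed
  have "?X + c < d ^ t"
  proof (cases "card B \<le> c")
    case True
    have "?X \<le> (d ^ (t - 1) - d ^ J) + card B * (d ^ (n - t) - 1)"
      using card_near_window[of J "t - 1"] J t t2 by simp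
    also have "\<dots> \<le> (d ^ (t - 1) - d ^ J) + c * (d ^ (n - t) - 1)"
      using True by simp
    finally have "?X + c \<le> (d ^ (t - 1) - d ^ J) + (c * (d ^ (n - t) - 1) + c)"
      by simp
    also have "c * (d ^ (n - t) - 1) + c = c * d ^ (n - t)"
      using d by (simp add: diff_mult_distrib2)
    \<comment> \<open>The strictness comes from the subtracted \<open>d ^ J\<close>, which is
      positive.\<close>
    also have "d ^ (t - 1) - d ^ J + c * d ^ (n - t) < d ^ t"
    proof -
      have "0 < d ^ J" "0 < d ^ (t - 1)"
        using d by simp_all
      then show ?thesis
        using c_mult by linarith
    qed
    finally show ?thesis .
  next
    case False
    moreover have "?X \<le> d ^ t - card B"
      using card_near[of "n - t" J] t by simp
    \<comment> \<open>Covers the case in which the truncated difference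
      \<open>d ^ t - card B\<close> is 0.\<close>
    moreover have "c < d ^ t"
    proof -
      have "c \<le> c * d ^ (n - t)" "0 < d ^ (t - 1)"
        using d by simp_all
      then show ?thesis
        using c_mult by linarith
    qed
    ultimately show ?thesis by linarith
  qed
  then show ?thesis
    by (simp add: c_def e_def)
qed

text \<open>For \<open>n + 1 \<le> 2 * t\<close> this is \<open>card_window_nat\<close>. Otherwise
  \<open>2 * t\<close> is \<open>n\<close> or \<open>n - 1\<close>, the exponent is negative, and
  counting all outputs of the window suffices.\<close>

lemma card_window:
  assumes d2: "d \<ge> 2" and J: "J < n - t" and t2: "n div 2 \<le> t"
  shows "real (card (plane ` {y \<in> near (n - t). src y \<notin> A J}))
    < real d ^ t - (real d - 1) * real d powi (2 * int t - int n - 1)"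
proof (cases "n + 1 \<le> 2 * t")
  case True
  let ?X = "card (plane ` {y \<in> near (n - t). src y \<notin> A J})"
  have "real (?X + (d - 1) * d ^ (2 * t - n - 1)) < real (d ^ t)"
    using card_window_nat[OF d2 J True] by (simp only: of_nat_less_iff)
  moreover have "2 * int t - int n - 1 = int (2 * t - n - 1)"
    using True by simp
  then have "real d powi (2 * int t - int n - 1) = real d ^ (2 * t - n - 1)"
    by (simp only: power_int_of_nat)
  ultimately show ?thesis
    using d by (simp add: of_nat_diff)
next
  case False \<comment> \<open>the subtracted term is a proper fraction, and the count is an integer\<close>
  then have e: "2 * int t - int n - 1 = - 1 \<or> 2 * int t - int n - 1 = - 2"
    using t2 by presburger
  have "(real d - 1) * real d powi - 1 < 1"
    using d2 by (simp add: power_int_minus field_simps)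
  moreover have "(real d - 1) * real d powi - 2 < 1"
  proof -
    have "real d * 1 \<le> real d * real d"
      using d2 by (intro mult_left_mono) auto
    then have "real d < 1 + real d * real d" by linarith
    then show ?thesis
      using d2 by (simp add: power_int_minus field_simps power2_eq_square)
  qed
  ultimately have "(real d - 1) * real d powi (2 * int t - int n - 1) < 1"
    using e by (elim disjE) (simp_all only:)
  moreover have "real (card (plane ` {y \<in> near (n - t). src y \<notin> A J})) \<le> real d ^ t - 1"
    using card_near_real[of "n - t" J] t by simp
  ultimately show ?thesis by linarith
qed

text \<open>The thresholds balance competing terms, with \<open>d ^ r\<close> as the size of
  \<open>f\<close>. The strict inequality allows for a bound that is not an integer.\<close>

lemma card_planes_less:
  assumes d2: "d \<ge> 2" and f: "f \<ge> 1"
  shows "real (card (plane ` Y)) < 1 + window_bound d n t f"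
proof -
  let ?D = "real d" and ?F = "real f" and ?X = "real (card (plane ` Y))"
  let ?N = "\<lambda>h J. real (card (plane ` {y \<in> near h. src y \<notin> A J}))"
  define r where "r = nat \<lfloor>log ?D ?F\<rfloor>"
  have r: "\<lfloor>log ?D ?F\<rfloor> = int r"
    using d2 f by (simp add: r_def)
  have half: "\<lfloor>real n / 2\<rfloor> = int (n div 2)"
    using floor_divide_of_nat_eq[of n 2] by simp
  have g: "\<lfloor>real_of_int (int n + int r) / 2\<rfloor> = int ((n + r) div 2)"
    using floor_divide_of_nat_eq[of "n + r" 2] by simp
  consider
      (1) "t < n div 2" "r + 2 * t + 1 \<le> n"
    | (2) "t < n div 2" "n < r + 2 * t + 1"
    | (3) "n div 2 \<le> t" "n - t \<le> r"
    | (4) "n div 2 \<le> t" "r < n - t" "2 * t < n + r + 2"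
    | (5) "n div 2 \<le> t" "r < n - t" "n + r + 2 \<le> 2 * t"
    by linarith
  then show ?thesis
  proof cases
    case 1
    \<comment> \<open>No layer is counted as a product: \<open>J = h - 1\<close>. This
      \<open>h\<close> makes the exponents of \<open>d ^ r * d ^ (h - 1)\<close> and
      \<open>d ^ (n - h)\<close> differ by at most one.\<close>
    define h where "h = (n - r + 1) div 2"
    have ceil: "\<lceil>real_of_int (int n - int r) / 2\<rceil> = int h"
    proof -
      have "n - r = 2 * h \<or> n - r + 1 = 2 * h"
        unfolding h_def by presburger
      then have "real n - real r = 2 * real h \<or> real n - real r + 1 = 2 * real h"
        using 1 by linarith
      then show ?thesis
        by (intro ceiling_unique) auto
    qed
    have h: "1 \<le> h" "h \<le> n - t"
      using 1 by (auto simp: h_def)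
    then have e: "int h - 1 = int (h - 1)" "int n - int h = int (n - h)"
      by auto
    have "int t < int (n div 2)" "int r \<le> int n - 2 * int t - 1"
      using 1 by linarith+
    then have "window_bound d n t f = ?F * (?D ^ (h - 1) - 1) + ?D ^ (n - h) - 1"
      unfolding window_bound_def Let_def r half ceil
      by (simp only: if_True e power_int_of_nat)
    moreover have "?X \<le> ?F * (?D ^ (h - 1) - 1) + ?N h (h - 1)"
      using card_planes_real[of "h - 1" 0] h by simp
    ultimately show ?thesis
      using card_near_real[OF h(2), of "h - 1"] by linarith
  next
    case 2
    \<comment> \<open>Here \<open>J = 0\<close> and \<open>h = t + 1\<close>: nothing is charged to
      the fanout, and the count of the near outputs cancels the term
      \<open>- d ^ (n - t - 1)\<close> of the layer sum.\<close>
    have e: "int n - int t - 1 = int (n - t - 1)" "int n - 2 * int t - 1 = int (n - 2 * t - 1)"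
      using 2 by auto
    have "int t < int (n div 2)" "\<not> int r \<le> int n - 2 * int t - 1"
      using 2 by linarith+
    then have "window_bound d n t f = real t * (?D - 1) * ?D ^ (n - t - 1) + ?D ^ (n - 2 * t - 1) - 1"
      unfolding window_bound_def Let_def r half
      by (simp only: if_True if_False e(1)) (simp only: e(2) power_int_of_nat)
    moreover have "?X \<le> real t * (?D - 1) * ?D ^ (n - t - 1) - ?D ^ (n - t - 1)
        + ?D ^ (n - t - 1 - t) + ?N (Suc t) 0"
      using card_planes_real[of 0 t] 2 by simp
    moreover have "n - t - 1 - t = n - 2 * t - 1" by simp
    moreover have "?N (Suc t) 0 \<le> ?D ^ (n - t - 1) - 1"
      using card_near_real[of "Suc t" 0] 2 by simp
    ultimately show ?thesis
      by simp
  next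
    case 3
    \<comment> \<open>Here \<open>J = 0\<close> and \<open>h = n - t\<close>: all layers outside the
      window are counted as products.\<close>
    have e: "int n - int t - 1 = int (n - t - 1)"
      using t by simp
    have "\<not> int t < int (n div 2)" "int r \<ge> int n - int t"
      using 3 by linarith+
    then have "window_bound d n t f = ((real n - real t - 1) * (?D - 1) - 1) * ?D ^ (n - t - 1)
        + ?D ^ t - (?D - 1) * ?D powi (2 * int t - int n - 1)"
      unfolding window_bound_def Let_def r half by (simp only: if_True if_False e power_int_of_nat)
    moreover have eq: "real (n - t - 1) = real n - real t - 1" "Suc (0 + (n - t - 1)) = n - t"
      using t by auto
    have "?X \<le> (real n - real t - 1) * (?D - 1) * ?D ^ (n - t - 1) - ?D ^ (n - t - 1)
        + 1 + ?N (n - t) 0"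
      using card_planes_real[of 0 "n - t - 1"] t unfolding eq by simp
    moreover have "?N (n - t) 0 < ?D ^ t - (?D - 1) * ?D powi (2 * int t - int n - 1)"
      using card_window[OF d2 _ 3(1), of 0] t by simp
    ultimately show ?thesis
      unfolding left_diff_distrib[of "_ * _"] by linarith
  next
    case 4
    \<comment> \<open>This \<open>J\<close> satisfies
      \<open>d ^ r * d ^ J = d ^ (n - t - 1)\<close>, so the fanout term matches the order of one
      layer; the remaining \<open>r\<close> layers are products.\<close>
    define J where "J = n - t - r - 1"
    have J: "J < n - t" "J + r < n - t" "Suc (J + r) = n - t" "n - t - 1 - r = J"
      using 4 by (auto simp: J_def)
    have e: "int n - int t - 1 = int (n - t - 1)" "int n - int t - int r - 1 = int J"
      using 4 by (auto simp: J_def)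
    have "\<not> int t < int (n div 2)" "\<not> int r \<ge> int n - int t" "2 * int t - int n - 2 < int r"
      using 4 by linarith+
    then have "window_bound d n t f = ?F * (?D ^ J - 1) + (real r * (?D - 1) - 1) * ?D ^ (n - t - 1)
        + ?D ^ J + ?D ^ t - (?D - 1) * ?D powi (2 * int t - int n - 1)"
      unfolding window_bound_def Let_def r half
      by (simp only: if_True if_False e power_int_of_nat of_int_of_nat_eq)
    moreover have "?X \<le> ?F * (?D ^ J - 1) + real r * (?D - 1) * ?D ^ (n - t - 1)
        - ?D ^ (n - t - 1) + ?D ^ J + ?N (n - t) J"
      using card_planes_real[OF J(2)] by (simp only: J)
    moreover have "?N (n - t) J < ?D ^ t - (?D - 1) * ?D powi (2 * int t - int n - 1)"
      by (rule card_window[OF d2 J(1) 4(1)])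
    ultimately show ?thesis
      unfolding left_diff_distrib[of "_ * _"] by linarith
  next
    case 5
    \<comment> \<open>\<open>J\<close> is as in the previous case. \<open>G\<close> makes the
      exponents of \<open>d ^ G\<close> and \<open>d ^ r * d ^ (n - G - 1)\<close> differ by at most
      one.\<close>
    define J G where "J = n - t - r - 1" and "G = (n + r) div 2"
    have J: "J < n - t" "J + r < n - t" "Suc (J + r) = n - t" "n - t - 1 - r = J"
      and G: "J \<le> G" "G < n"
      using 5 t by (auto simp: J_def G_def)
    have e: "int n - int t - 1 = int (n - t - 1)" "int n - int t - int r - 1 = int J"
      "int n - int G - 1 = int (n - G - 1)"
      using 5 G by (auto simp: J_def)
    have "\<not> int t < int (n div 2)" "\<not> int r \<ge> int n - int t" "\<not> 2 * int t - int n - 2 < int r"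
      using 5 by linarith+
    then have "window_bound d n t f = ?F * (?D ^ J - 1) + (real r * (?D - 1) - 1) * ?D ^ (n - t - 1)
        + ?D ^ G + ?F * (?D ^ (n - G - 1) - 1)"
      unfolding window_bound_def Let_def r half g G_def[symmetric]
      by (simp only: if_True if_False e power_int_of_nat of_int_of_nat_eq)
    moreover have "?X \<le> ?F * (?D ^ J - 1) + real r * (?D - 1) * ?D ^ (n - t - 1)
        - ?D ^ (n - t - 1) + ?D ^ J + ?N (n - t) J"
      using card_planes_real[OF J(2)] by (simp only: J)
    \<comment> \<open>The term \<open>- ?D ^ J\<close> cancels the \<open>?D ^ J\<close> left over
      from the layer sum.\<close>
    moreover have "?N (n - t) J \<le> ?D ^ G - ?D ^ J + ?F * (?D ^ (n - G - 1) - 1)"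
    proof -
      have "card (plane ` {y \<in> near (n - t). src y \<notin> A J})
          \<le> (d ^ G - d ^ J) + f * (d ^ (n - G - 1) - 1)"
        using card_near_window[OF G] B(3)
        by (meson add_left_mono le_trans mult_right_mono zero_le)
      then have "?N (n - t) J \<le> real ((d ^ G - d ^ J) + f * (d ^ (n - G - 1) - 1))"
        by (simp only: of_nat_le_iff)
      also have "d ^ J \<le> d ^ G"
        using d G by (intro power_increasing) auto
      then have "real ((d ^ G - d ^ J) + f * (d ^ (n - G - 1) - 1))
          = ?D ^ G - ?D ^ J + ?F * (?D ^ (n - G - 1) - 1)"
        using d by (simp add: of_nat_diff)
      finally show ?thesis .
    qed
    ultimately show ?thesis
      unfolding left_diff_distrib[of "_ * _"] by linarith
  qed
qed

end

section \<open>Reachable states and the choice of planes\<close>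

lemma reachable_connection:
  assumes "reachable d n m t f S" "c \<in> S"
  shows "source c \<in> words d n \<and> dests c \<subseteq> words d n \<and> card (dests c) \<le> f \<and> window_rule d n t c"
  using assms by induction (auto simp: fcast_request_def routable_def)

text \<open>Makes the request behind an input or an output unique, so that sources and planes become
  functions of the output.\<close>

lemma reachable_disjoint:
  assumes "reachable d n m t f S" "c \<in> S" "c' \<in> S" "c \<noteq> c'"
  shows "source c \<noteq> source c' \<and> dests c \<inter> dests c' = {}"
  using assms
proof induction
  case (arrive S x)
  have new: "source y \<noteq> source x \<and> dests y \<inter> dests x = {}" if "y \<in> S" for y
    using arrive.hyps(2) that by (simp add: fcast_request_def)
  consider "c \<in> S" "c' \<in> S" | "c = x" "c' \<in> S" | "c \<in> S" "c' = x"
    using arrive.prems by blast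
  then show ?case
  proof cases
    case 1
    then show ?thesis using arrive.IH arrive.prems by simp
  next
    case 2
    then show ?thesis using new[of c'] by auto
  next
    case 3
    then show ?thesis using new[of c] by simp
  qed
qed simp_all

text \<open>A plane is unusable only if it carries an output of \<open>Y\<close>, and
  \<open>card_planes_less\<close> leaves fewer than \<open>m\<close> such planes.\<close>

lemma free_plane:
  assumes d: "d \<ge> 2" and m1: "m \<ge> 1" and t: "t < n" and f: "1 \<le> f" and m: "1 + window_bound d n t f \<le> real m"
    and S: "reachable d n m t f S" and req: "fcast_request d n f S a B"
    and w: "w \<in> words d (n - t)"
  shows "\<exists>p < m. \<forall>b \<in> B \<inter> window d n t w. \<forall>c \<in> S. \<forall>y \<in> dests c.
    plane_of c y = p \<longrightarrow> route n a b \<inter> route n (source c) y = {}"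
proof (cases "B \<inter> window d n t w = {}")
  case True
  \<comment> \<open>An empty subrequest accepts any plane; plane 0 exists as
    \<open>m \<ge> 1\<close>.\<close>
  then show ?thesis using m1 by (intro exI[of _ 0]) simp
next
  case False
  let ?B = "B \<inter> window d n t w"
  define Y where "Y = {y. \<exists>c \<in> S. y \<in> dests c \<and> (\<exists>b \<in> ?B. route n a b \<inter> route n (source c) y \<noteq> {})}"
  have inv: "source c \<in> words d n" "dests c \<subseteq> words d n" "card (dests c) \<le> f" "window_rule d n t c"
    if "c \<in> S" for c
    using reachable_connection[OF S that] by blast+
  have disj: "source c \<noteq> source c'" "dests c \<inter> dests c' = {}" if "c \<in> S" "c' \<in> S" "c \<noteq> c'" for c c'
    using reachable_disjoint[OF S that] by blast+
  have a: "a \<in> words d n" "B \<subseteq> words d n" "card B \<le> f"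
    and new: "\<And>c. c \<in> S \<Longrightarrow> source c \<noteq> a \<and> dests c \<inter> B = {}"
    using req by (auto simp: fcast_request_def)
  have "\<forall>y \<in> Y. \<exists>c. c \<in> S \<and> y \<in> dests c"
    by (auto simp: Y_def)
  then obtain conn where "\<forall>y \<in> Y. conn y \<in> S \<and> y \<in> dests (conn y)"
    using bchoice[of Y "\<lambda>y c. c \<in> S \<and> y \<in> dests c"] by blast
  then have conn: "conn y \<in> S" "y \<in> dests (conn y)" if "y \<in> Y" for y
    using that by auto
  have conn_eq: "c = conn y" if "y \<in> Y" "c \<in> S" "y \<in> dests c" for c y
    using that conn disj(2)[of c "conn y"] by blast
  have finite_dests: "finite (dests c)" if "c \<in> S" for c
    using inv(2)[OF that] finite_subset finite_words by blast
  let ?plane = "\<lambda>y. plane_of (conn y) y"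
  interpret blocked_subrequest d n t f a w ?B Y "\<lambda>y. source (conn y)" ?plane
  proof
    show "1 \<le> d" using d by simp
    show "t < n" "a \<in> words d n" "w \<in> words d (n - t)" "?B \<noteq> {}"
      using t a w False by auto
    show "?B \<subseteq> window d n t w" by simp
    have "finite B"
      using a(2) finite_subset finite_words by blast
    then show "card ?B \<le> f"
      using a(3) card_mono[of B ?B] by simp
    show "Y \<subseteq> words d n"
      using inv(2) by (auto simp: Y_def)
    show "Y \<inter> ?B = {}"
      using new by (auto simp: Y_def)
  next
    fix x
    show "card {y \<in> Y. source (conn y) = x} \<le> f"
    proof (cases "\<exists>y \<in> Y. source (conn y) = x")
      case True
      then obtain y0 where y0: "y0 \<in> Y" "source (conn y0) = x" by blast
      \<comment> \<open>Different requests have different sources, so all outputs fed by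
        \<open>x\<close> belong to one request and their number is at most its fanout.\<close>
      have "conn y = conn y0" if "y \<in> Y" "source (conn y) = x" for y
        using disj(1)[OF conn(1)[OF that(1)] conn(1)[OF y0(1)]] that y0 by auto
      then have "{y \<in> Y. source (conn y) = x} \<subseteq> dests (conn y0)"
        using conn(2) by fastforce
      then show ?thesis
        using card_mono[OF finite_dests[OF conn(1)[OF y0(1)]]] inv(3)[OF conn(1)[OF y0(1)]]
        by (meson le_trans)
    next
      case False
      then have "{y \<in> Y. source (conn y) = x} = {}" by blast
      then show ?thesis by (simp only: card.empty)
    qed
  next
    fix y y'
    assume y: "y \<in> Y" "y' \<in> Y" "source (conn y) = source (conn y')" "take (n - t) y = take (n - t) y'"
    have eq: "conn y = conn y'"
      using disj(1)[OF conn(1)[OF y(1)] conn(1)[OF y(2)]] y(3) by blast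
    have words: "y \<in> words d n" "y' \<in> words d n"
      using y conn inv(2) by blast+
    then have "take (n - t) y \<in> words d (n - t)"
      by (intro take_in_words) auto
    then obtain p where "\<forall>b \<in> dests (conn y) \<inter> window d n t (take (n - t) y). plane_of (conn y) b = p"
      using inv(4)[OF conn(1)[OF y(1)]] unfolding window_rule_def by blast
    then show "?plane y = ?plane y'"
      using conn(2)[OF y(1)] conn(2)[OF y(2)] words y(4) unfolding eq by (simp add: window_def)
  next
    fix y assume y: "y \<in> Y"
    then obtain c b where "c \<in> S" "y \<in> dests c"
      and "b \<in> ?B" "route n a b \<inter> route n (source c) y \<noteq> {}"
      unfolding Y_def by blast
    then have b: "b \<in> ?B" "route n a b \<inter> route n (source (conn y)) y \<noteq> {}"
      using conn_eq[OF y] by auto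
    have words: "b \<in> words d n" "y \<in> words d n"
      using a(2) b(1) inv(2)[OF conn(1)[OF y]] conn(2)[OF y] by blast+
    have "y \<noteq> b"
      using new[OF conn(1)[OF y]] conn(2)[OF y] b by auto
    then show "\<exists>j b. 1 \<le> j \<and> j < n \<and> source (conn y) \<in> merging_inputs d n a j \<and> b \<in> ?B \<and> take j y = take j b"
      using route_Int[OF a(1) inv(1)[OF conn(1)[OF y]] words _ _ b(2)] new[OF conn(1)[OF y]] b(1)
      by blast
  qed
  have "card (?plane ` Y) < card {..<m}"
    using card_planes_less[OF \<open>d \<ge> 2\<close> f] m by simp
  then have "\<not> {..<m} \<subseteq> ?plane ` Y"
    using card_mono[OF finite_imageI[OF finite_Y]] leD by blast
  then obtain p where p: "p < m" "p \<notin> ?plane ` Y" by auto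
  have "route n a b \<inter> route n (source c) y = {}"
    if "b \<in> ?B" "c \<in> S" "y \<in> dests c" "plane_of c y = p" for b c y
  proof (rule ccontr)
    assume "route n a b \<inter> route n (source c) y \<noteq> {}"
    then have y: "y \<in> Y"
      unfolding Y_def using that by blast
    then have "?plane y = p"
      using conn_eq that by auto
    then show False
      using y p(2) by blast
  qed
  then show ?thesis
    using p(1) by blast
qed

text \<open>Routes from one input may share links, so the planes chosen for different windows do not
  interact and each window can be served by \<open>free_plane\<close> separately.\<close>

theorem theorem4p8:
  fixes d n m t f :: nat
  assumes "d \<ge> 2" and "n \<ge> 1" and "m \<ge> 1"
    and "t < n"
    and "1 \<le> f" and "f \<le> d ^ n"
    and "real m \<ge> 1 + window_bound d n t f"
  shows "window_nonblocking d n m t f"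
  unfolding window_nonblocking_def
proof (intro allI impI)
  fix S a B
  assume S: "reachable d n m t f S" and req: "fcast_request d n f S a B"
  let ?free = "\<lambda>w p. p < m \<and> (\<forall>b \<in> B \<inter> window d n t w. \<forall>c \<in> S. \<forall>y \<in> dests c.
    plane_of c y = p \<longrightarrow> route n a b \<inter> route n (source c) y = {})"
  have "\<forall>w \<in> words d (n - t). \<exists>p. ?free w p"
    using free_plane[OF assms(1,3,4,5,7) S req] by blast
  then obtain P where P: "\<forall>w \<in> words d (n - t). ?free w (P w)"
    using bchoice[of "words d (n - t)" ?free] by blast
  \<comment> \<open>The plane depends on the window prefix of the output alone, which is the window
    rule.\<close>
  let ?c = "Connection a B (\<lambda>b. P (take (n - t) b))"
  have B: "b \<in> window d n t (take (n - t) b)" "take (n - t) b \<in> words d (n - t)" if "b \<in> B" for b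
    using that req by (auto simp: fcast_request_def window_def intro: take_in_words)
  have "routable d n m t S ?c"
    unfolding routable_def
  proof (intro conjI ballI)
    fix b assume "b \<in> dests ?c"
    then show "plane_of ?c b < m" using P B by simp
  next
    show "window_rule d n t ?c"
      by (auto simp: window_rule_def window_def)
  next
    fix c assume c: "c \<in> S"
    show "used_links n ?c \<inter> used_links n c = {}"
    proof (rule ccontr)
      assume "used_links n ?c \<inter> used_links n c \<noteq> {}"
      then obtain p l where "(p, l) \<in> used_links n ?c" "(p, l) \<in> used_links n c"
        by auto
      then obtain b y where bl: "b \<in> B" "y \<in> dests c" "plane_of c y = P (take (n - t) b)"
        "l \<in> route n a b" "l \<in> route n (source c) y"
        by (auto simp: used_links_def)
      then have "route n a b \<inter> route n (source c) y = {}"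
        using P B[OF bl(1)] c by blast
      then show False using bl by blast
    qed
  qed
  then show "\<exists>c. source c = a \<and> dests c = B \<and> routable d n m t S c"
    by (intro exI[of _ ?c]) (simp only: connection.sel)
qed

end
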